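(* Let $\Gamma=(\gamma_n)_{n\ge1}$ be a sequence of distinct complex numbers satisfying the sparseness condition $\inf_{n\ge1}|\gamma_{n+1}|/|\gamma_n|>1$, and let $v=(v_n)_{n\ge1}$ be a sequence of positive numbers that is admissible for $\Gamma$, i.e. $\sum_{n=1}^\infty v_n/(1+|\gamma_n|^2)<\infty$. Let $\mu$ be a nonnegative measure on $\mathbb{C}$ with $\mu(\Gamma)=0$. Then the map $H_{(\Gamma,v)}$ is bounded from $\ell^2_v$ to $L^2(\mathbb{C},\mu)$ if and only if \[ \sup_{n\ge1}\int_{\Omega_n}\frac{v_n\,d\mu(z)}{|z-\gamma_n|^2}<\infty \] and \[ \sup_{n\ge1}\left(\sum_{l=1}^{n}v_l\sum_{m=n+1}^\infty\int_{\Omega_m}\frac{d\mu(z)}{|z|^2}+\sum_{m=1}^{n}\mu(\Omega_m)\sum_{l=n+1}^\infty\frac{v_l}{|\gamma_l|^2}\right)<\infty. \]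
   Context: $\ell^2_v=\{a=(a_n)_{n\ge1}:\ \|a\|_v^2=\sum_n|a_n|^2v_n<\infty\}$. For $a\in\ell^2_v$ and $z\in\mathbb{C}\setminus\Gamma$, $H_{(\Gamma,v)}a(z)=\sum_{n=1}^\infty \frac{a_nv_n}{z-\gamma_n}$ (under the admissibility and sparseness conditions this series converges absolutely for every $z\in\mathbb{C}\setminus\Gamma$). The sets $\Omega_n$ partition $\mathbb{C}$: $\Omega_1=\{z:|z|<(|\gamma_1|+|\gamma_2|)/2\}$ and, for $n\ge2$, $\Omega_n=\{z:(|\gamma_{n-1}|+|\gamma_n|)/2\le|z|<(|\gamma_n|+|\gamma_{n+1}|)/2\}$. *)

theory Defs
  imports "HOL-Analysis.Analysis" "HOL-Probability.Probability"
begin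

text \<open>Sequences are indexed from 1 as in the paper; the value at index 0 is ignored.\<close>

definition lv2 :: "(nat \<Rightarrow> real) \<Rightarrow> (nat \<Rightarrow> complex) \<Rightarrow> bool" where
  "lv2 v a \<longleftrightarrow> summable (\<lambda>n. (cmod (a (Suc n)))\<^sup>2 * v (Suc n))"

definition lv2_norm_sq :: "(nat \<Rightarrow> real) \<Rightarrow> (nat \<Rightarrow> complex) \<Rightarrow> real" where
  "lv2_norm_sq v a = (\<Sum>n. (cmod (a (Suc n)))\<^sup>2 * v (Suc n))"

definition Hop :: "(nat \<Rightarrow> complex) \<Rightarrow> (nat \<Rightarrow> real) \<Rightarrow> (nat \<Rightarrow> complex) \<Rightarrow> complex \<Rightarrow> complex" where
  "Hop \<gamma> v a z = (\<Sum>n. a (Suc n) * complex_of_real (v (Suc n)) / (z - \<gamma> (Suc n)))"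

definition Omega :: "(nat \<Rightarrow> complex) \<Rightarrow> nat \<Rightarrow> complex set" where
  "Omega \<gamma> n = (if n = 1 then {z. cmod z < (cmod (\<gamma> 1) + cmod (\<gamma> 2)) / 2}
     else {z. (cmod (\<gamma> (n - 1)) + cmod (\<gamma> n)) / 2 \<le> cmod z \<and>
              cmod z < (cmod (\<gamma> n) + cmod (\<gamma> (Suc n))) / 2})"

end

theory Submission
  imports Defs
begin

text \<open>
  On \<open>\<Omega>\<^sub>m\<close> the kernel \<open>1 / (z - \<gamma>\<^sub>l)\<close> is comparable to \<open>1 / z\<close> for \<open>l < m\<close> and to
  \<open>1 / \<gamma>\<^sub>l\<close> for \<open>l > m\<close>, uniformly by sparseness. Hence boundedness of the operator reduces to
  the diagonal terms, which give the first condition, and to two discrete Hardy inequalities with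
  weights, one dual to the other, whose Muckenhoupt characterizations are the two halves of the
  second condition. For sufficiency these inequalities are applied to the truncated sums and
  Fatou's lemma removes the truncation. For necessity one tests on unit vectors, on \<open>1\<close> for \<open>l \<le> n\<close>,
  and on \<open>1 / cnj \<gamma>\<^sub>l\<close> for \<open>n < l \<le> n + k\<close>; there is no cancellation because
  \<open>Re (1 / (1 - w)) \<ge> 1 / 2\<close> whenever \<open>\<bar>w\<bar> < 1\<close>.
\<close>

subsection \<open>Discrete Hardy inequalities with weights\<close>

text \<open>Hardy's inequality in exponent 2 for weighted averages, with the classical constant 4.
  The quantity \<open>V N * (A N)\<^sup>2\<close> serves as a potential: its increments show that
  the sum of \<open>v A\<^sup>2\<close> is at most that of \<open>2 v A b\<close>.\<close>

lemma weighted_average_square_sum: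
  fixes b v :: "nat \<Rightarrow> real"
  assumes v: "\<And>l. v l > 0"
  shows "(\<Sum>l<N. v l * ((\<Sum>i\<le>l. b i * v i) / (\<Sum>i\<le>l. v i))\<^sup>2) \<le> 4 * (\<Sum>l<N. v l * (b l)\<^sup>2)"
proof -
  define S where "S k = (\<Sum>i<k. b i * v i)" for k
  define V where "V k = (\<Sum>i<k. v i)" for k
  define A where "A k = S k / V k" for k
  have V0: "V k \<ge> 0" for k
    unfolding V_def using v by (intro sum_nonneg) (simp add: less_imp_le)
  \<comment> \<open>For \<open>k = 0\<close> the quotient \<open>A 0\<close> is 0 by the convention
    on division, and both sides vanish.\<close>
  have S_eq: "S k = V k * A k" for k
  proof (cases k)
    case (Suc j)
    have "V k > 0" unfolding V_def Suc using v by (intro sum_pos) auto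
    then show ?thesis by (simp add: A_def)
  qed (simp add: S_def V_def)
  \<comment> \<open>The slack in each step is the square \<open>V N * (A (Suc N) - A N)\<^sup>2\<close>, so no Cauchy-Schwarz is needed.\<close>
  have telescope: "(\<Sum>l<N. v l * (A (Suc l))\<^sup>2 - 2 * v l * A (Suc l) * b l) + V N * (A N)\<^sup>2 \<le> 0"
  proof (induction N)
    case (Suc N)
    have "V (Suc N) * A (Suc N) = V N * A N + b N * v N"
      using S_eq[of N] S_eq[of "Suc N"] by (simp add: S_def)
    then have step: "v N * b N = V (Suc N) * A (Suc N) - V N * A N" by simp
    have vN: "V (Suc N) = V N + v N" by (simp add: V_def)
    have "v N * (A (Suc N))\<^sup>2 - 2 * v N * A (Suc N) * b N + V (Suc N) * (A (Suc N))\<^sup>2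
        = v N * (A (Suc N))\<^sup>2 - 2 * A (Suc N) * (v N * b N) + V (Suc N) * (A (Suc N))\<^sup>2"
      by (simp add: algebra_simps)
    also have "\<dots> = V N * (A N)\<^sup>2 - V N * (A (Suc N) - A N)\<^sup>2"
      unfolding step vN by (simp add: algebra_simps power2_eq_square)
    also have "\<dots> \<le> V N * (A N)\<^sup>2" using V0[of N] by simp
    finally show ?case using Suc by simp
  qed (simp add: V_def)
  \<comment> \<open>AM-GM is weighted so that half of \<open>v l * (A (Suc l))\<^sup>2\<close> is
    absorbed by the left-hand side; doubling the remaining factor 2 gives the constant 4.\<close>
  have "2 * v l * A (Suc l) * b l \<le> v l * (A (Suc l))\<^sup>2 / 2 + 2 * (v l * (b l)\<^sup>2)" for l
  proof -
    have "0 \<le> v l / 2 * (A (Suc l) - 2 * b l)\<^sup>2" using v[of l] by simp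
    then show ?thesis by (simp add: algebra_simps power2_eq_square)
  qed
  then have "(\<Sum>l<N. 2 * v l * A (Suc l) * b l) \<le>
      (\<Sum>l<N. v l * (A (Suc l))\<^sup>2 / 2 + 2 * (v l * (b l)\<^sup>2))"
    by (intro sum_mono)
  also have "\<dots> = (\<Sum>l<N. v l * (A (Suc l))\<^sup>2) / 2 + 2 * (\<Sum>l<N. v l * (b l)\<^sup>2)"
    by (simp add: sum.distrib sum_divide_distrib sum_distrib_left)
  finally have "(\<Sum>l<N. v l * (A (Suc l))\<^sup>2) \<le> 4 * (\<Sum>l<N. v l * (b l)\<^sup>2)"
    using telescope mult_nonneg_nonneg[OF V0[of N] zero_le_power2[of "A N"]]
    by (simp add: sum_subtractf)
  then show ?thesis by (simp add: A_def S_def V_def lessThan_Suc_atMost)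
qed

text \<open>This is the sufficient direction of Muckenhoupt's criterion: the tails of
  \<open>w\<close> are at most \<open>K / V\<close>, and after this replacement the inequality for
  averages applies. The constant does not depend on \<open>N\<close>, which later allows the
  truncation to be removed.\<close>

lemma weighted_hardy:
  fixes b v w :: "nat \<Rightarrow> real"
  assumes v: "\<And>l. v l > 0" and b: "\<And>l. b l \<ge> 0" and w: "\<And>l. w l \<ge> 0"
    and K: "\<And>n. 0 < n \<Longrightarrow> n \<le> N \<Longrightarrow> (\<Sum>l<n. v l) * (\<Sum>m=n..<N. w m) \<le> K"
  shows "(\<Sum>m<N. w m * (\<Sum>l<m. b l * v l)\<^sup>2) \<le> 4 * K * (\<Sum>l<N. (b l)\<^sup>2 * v l)"
proof (cases "N = 0")
  case False
  define S where "S k = (\<Sum>i<k. b i * v i)" for k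
  define V where "V k = (\<Sum>i<k. v i)" for k
  define T where "T k = (\<Sum>m=k..<N. w m)" for k
  have T0: "T k \<ge> 0" for k unfolding T_def by (intro sum_nonneg w)
  have V0: "V (Suc k) > 0" for k unfolding V_def using v by (intro sum_pos) auto
  have S0: "S k \<ge> 0" for k
    unfolding S_def by (intro sum_nonneg mult_nonneg_nonneg b less_imp_le[OF v])
  \<comment> \<open>At \<open>n = N\<close> the tail is empty and the hypothesis reads
    \<open>0 \<le> K\<close>.\<close>
  have K0: "K \<ge> 0" using K[of N] False by simp
  have T_step: "T m = w m + T (Suc m)" if "m < N" for m
    using that by (simp add: T_def sum.atLeast_Suc_lessThan)
  \<comment> \<open>Summation by parts moves the weights \<open>w\<close> into their tails \<open>T\<close>, which the hypothesis bounds by \<open>K / V\<close>.\<close>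
  have parts: "n \<le> N \<Longrightarrow> (\<Sum>m<n. w m * (S m)\<^sup>2) + T n * (S n)\<^sup>2
      = (\<Sum>l<n. T (Suc l) * ((S (Suc l))\<^sup>2 - (S l)\<^sup>2))" for n
  proof (induction n)
    case (Suc n)
    then show ?case using T_step[of n] by (simp add: algebra_simps)
  qed (simp add: S_def)
  have term_le: "T (Suc l) * ((S (Suc l))\<^sup>2 - (S l)\<^sup>2)
      \<le> K * (v l * (S (Suc l) / V (Suc l))\<^sup>2 / 2 + 2 * ((b l)\<^sup>2 * v l))" if "l < N" for l
  proof -
    \<comment> \<open>With \<open>d = b l * v l\<close> the increment is
      \<open>2 * S (Suc l) * d - d\<^sup>2\<close>, and the negative square is dropped.\<close>
    have "(S (Suc l))\<^sup>2 - (S l)\<^sup>2 \<le> 2 * S (Suc l) * (b l * v l)"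
      using zero_le_power2[of "b l * v l"] by (simp add: S_def power2_eq_square algebra_simps)
    then have "T (Suc l) * ((S (Suc l))\<^sup>2 - (S l)\<^sup>2) \<le> T (Suc l) * (2 * S (Suc l) * (b l * v l))"
      by (intro mult_left_mono T0)
    \<comment> \<open>Inserting \<open>V (Suc l)\<close> and dividing it out again pairs the product
      bounded by \<open>K\<close> with the average \<open>S / V\<close>.\<close>
    also have "\<dots> = (V (Suc l) * T (Suc l)) * (2 * (S (Suc l) / V (Suc l)) * (b l * v l))"
      using V0[of l] by simp
    also have "\<dots> \<le> K * (2 * (S (Suc l) / V (Suc l)) * (b l * v l))"
      using K[of "Suc l"] that S0 V0[of l] b[of l] v[of l]
      by (intro mult_right_mono) (auto simp: V_def T_def less_imp_le simp del: sum.lessThan_Suc)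
    also have "\<dots> \<le> K * (v l * (S (Suc l) / V (Suc l))\<^sup>2 / 2 + 2 * ((b l)\<^sup>2 * v l))"
    proof (intro mult_left_mono K0)
      have "0 \<le> v l / 2 * (S (Suc l) / V (Suc l) - 2 * b l)\<^sup>2" using v[of l] by simp
      then show "2 * (S (Suc l) / V (Suc l)) * (b l * v l)
          \<le> v l * (S (Suc l) / V (Suc l))\<^sup>2 / 2 + 2 * ((b l)\<^sup>2 * v l)"
        unfolding power2_diff by (simp add: algebra_simps power2_eq_square)
    qed
    finally show ?thesis .
  qed
  have "(\<Sum>m<N. w m * (S m)\<^sup>2) \<le> (\<Sum>l<N. T (Suc l) * ((S (Suc l))\<^sup>2 - (S l)\<^sup>2))"
    using parts[of N] by (simp add: T_def)
  also have "\<dots> \<le> (\<Sum>l<N. K * (v l * (S (Suc l) / V (Suc l))\<^sup>2 / 2 + 2 * ((b l)\<^sup>2 * v l)))"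
    by (intro sum_mono term_le) simp
  also have "\<dots> = K * ((\<Sum>l<N. v l * (S (Suc l) / V (Suc l))\<^sup>2) / 2 + 2 * (\<Sum>l<N. (b l)\<^sup>2 * v l))"
    unfolding sum_distrib_left[symmetric] sum.distrib sum_divide_distrib by simp
  also have "\<dots> \<le> K * (4 * (\<Sum>l<N. v l * (b l)\<^sup>2) / 2 + 2 * (\<Sum>l<N. (b l)\<^sup>2 * v l))"
    using weighted_average_square_sum[OF v, where b = b and N = N]
    by (intro mult_left_mono K0) (simp add: S_def V_def lessThan_Suc_atMost)
  finally show ?thesis by (simp add: S_def algebra_simps)
qed simp

text \<open>This is the preceding inequality under the reflection \<open>l \<mapsto> N - 1 - l\<close>.\<close>

lemma weighted_hardy_dual:
  fixes c u w :: "nat \<Rightarrow> real"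
  assumes u: "\<And>l. u l > 0" and c: "\<And>l. c l \<ge> 0" and w: "\<And>l. w l \<ge> 0"
    and K: "\<And>n. n < N \<Longrightarrow> (\<Sum>m<n. w m) * (\<Sum>l=n..<N. u l) \<le> K"
  shows "(\<Sum>m<N. w m * (\<Sum>l=Suc m..<N. c l * u l)\<^sup>2) \<le> 4 * K * (\<Sum>l<N. (c l)\<^sup>2 * u l)"
proof -
  have tail: "(\<Sum>l<k. f (N - Suc l)) = (\<Sum>l=N - k..<N. f l)" if "k \<le> N" for k and f :: "nat \<Rightarrow> real"
    by (rule sum.reindex_bij_witness[of _ "\<lambda>l. N - Suc l" "\<lambda>l. N - Suc l"]) (use that in auto)
  have head: "(\<Sum>m=k..<N. f (N - Suc m)) = (\<Sum>m<N - k. f m)" for k and f :: "nat \<Rightarrow> real"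
    by (rule sum.reindex_bij_witness[of _ "\<lambda>l. N - Suc l" "\<lambda>l. N - Suc l"]) auto
  have "(\<Sum>m<N. w (N - Suc m) * (\<Sum>l<m. c (N - Suc l) * u (N - Suc l))\<^sup>2)
      \<le> 4 * K * (\<Sum>l<N. (c (N - Suc l))\<^sup>2 * u (N - Suc l))"
  proof (rule weighted_hardy)
    \<comment> \<open>A reflected initial segment of length \<open>n\<close> is a tail starting at
      \<open>N - n\<close>, so the hypothesis is used there; \<open>0 < n\<close> ensures
      \<open>N - n < N\<close>.\<close>
    fix n assume n: "0 < n" "n \<le> N"
    then show "(\<Sum>l<n. u (N - Suc l)) * (\<Sum>m=n..<N. w (N - Suc m)) \<le> K"
      using K[of "N - n"] by (simp add: tail head mult.commute)
  qed (use u c w in auto)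
  also have "(\<Sum>l<N. (c (N - Suc l))\<^sup>2 * u (N - Suc l)) = (\<Sum>l<N. (c l)\<^sup>2 * u l)"
    using tail[of N "\<lambda>l. (c l)\<^sup>2 * u l"] by (simp add: atLeast0LessThan)
  also have "(\<Sum>m<N. w (N - Suc m) * (\<Sum>l<m. c (N - Suc l) * u (N - Suc l))\<^sup>2)
      = (\<Sum>m<N. w (N - Suc m) * (\<Sum>l=N - m..<N. c l * u l)\<^sup>2)"
    using tail[of _ "\<lambda>l. c l * u l"] by (intro sum.cong) auto
  \<comment> \<open>Replacing \<open>m\<close> by \<open>N - Suc m\<close> turns the lower limit
    \<open>N - m\<close> into \<open>Suc m\<close>.\<close>
  also have "\<dots> = (\<Sum>m<N. w m * (\<Sum>l=Suc m..<N. c l * u l)\<^sup>2)"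
    by (rule sum.reindex_bij_witness[of _ "\<lambda>l. N - Suc l" "\<lambda>l. N - Suc l"]) (auto simp: Suc_diff_Suc)
  finally show ?thesis .
qed

section \<open>Upper and lower estimates for the Cauchy kernel\<close>

lemma cmod_inverse_diff_le:
  fixes u w :: complex
  assumes "cmod w \<le> \<theta> * cmod u" "\<theta> < 1" "u \<noteq> 0"
  shows "1 / cmod (u - w) \<le> 1 / (1 - \<theta>) / cmod u"
proof -
  have "(1 - \<theta>) * cmod u \<le> cmod (u - w)"
    using norm_triangle_ineq2[of u w] assms(1) by (simp add: algebra_simps)
  moreover have "(1 - \<theta>) * cmod u > 0" using assms by simp
  ultimately show ?thesis by (simp add: frac_le)
qed

text \<open>The point \<open>1 - w / u\<close> lies in the open disc of centre 1 and radius 1, which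
  inversion maps into the half-plane \<open>Re > 1 / 2\<close>. Algebraically,
  \<open>2 * Re (u * cnj (u - w))\<close> exceeds \<open>|u - w|\<^sup>2\<close> by
  \<open>|u|\<^sup>2 - |w|\<^sup>2\<close>.\<close>

lemma Re_divide_diff_ge_half:
  fixes u w :: complex
  assumes "cmod w < cmod u"
  shows "Re (u / (u - w)) \<ge> 1 / 2"
proof -
  have "u - w \<noteq> 0" using assms by auto
  then have pos: "(cmod (u - w))\<^sup>2 > 0" by simp
  have "(cmod w)\<^sup>2 \<le> (cmod u)\<^sup>2" using assms by (intro power_mono) auto
  then have "(cmod (u - w))\<^sup>2 \<le> 2 * Re (u * cnj (u - w))"
    unfolding cmod_power2 by (simp add: algebra_simps power2_eq_square)
  moreover have "Re (u / (u - w)) = Re (u * cnj (u - w)) / (cmod (u - w))\<^sup>2"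
    by (subst complex_div_cnj) (metis Re_divide_of_real of_real_power)
  ultimately have "1 / 2 * (cmod (u - w))\<^sup>2 \<le> Re (u / (u - w)) * (cmod (u - w))\<^sup>2"
    using pos by simp
  then show ?thesis using pos by (rule mult_right_le_imp_le)
qed

subsection \<open>Sparse sequences\<close>

text \<open>For finitely supported test sequences this turns the series indexed from 1 into finite
  sums; index 0 is excluded because the series skips it.\<close>

lemma sums_Suc_finite:
  fixes f :: "nat \<Rightarrow> 'a::real_normed_vector"
  assumes "finite F" "0 \<notin> F" "\<And>n. n \<notin> F \<Longrightarrow> f n = 0"
  shows "(\<lambda>n. f (Suc n)) sums (\<Sum>n\<in>F. f n)"
  using sums_finite[of F f] assms by (simp add: sums_Suc_iff)

locale sparse_sequence =
  fixes \<gamma> :: "nat \<Rightarrow> complex" and q :: real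
  assumes q: "q > 1"
    and nonzero: "\<And>n. n \<ge> 1 \<Longrightarrow> \<gamma> n \<noteq> 0"
    and growth: "\<And>n. n \<ge> 1 \<Longrightarrow> q * cmod (\<gamma> n) \<le> cmod (\<gamma> (Suc n))"
begin

text \<open>The midpoint of \<open>1 / q\<close> and 1. It arises from bounding the outer radius
  \<open>(|\<gamma> m| + |\<gamma> (Suc m)|) / 2\<close> of a shell by a multiple of
  \<open>|\<gamma> (Suc m)|\<close>.\<close>

definition \<theta> :: real where "\<theta> = (1 + q) / (2 * q)"

lemma \<theta>: "0 < \<theta>" "\<theta> < 1"
  using q by (auto simp: \<theta>_def)

lemma cmod_mono:
  assumes "1 \<le> i" "i \<le> j"
  shows "cmod (\<gamma> i) \<le> cmod (\<gamma> j)"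
  using assms(2)
proof (induction j rule: dec_induct)
  case (step n)
  have "cmod (\<gamma> n) \<le> q * cmod (\<gamma> n)" using q mult_right_mono[of 1 q "cmod (\<gamma> n)"] by simp
  then show ?case using step growth[of n] assms(1) by linarith
qed simp

lemma cmod_at_top: "filterlim (\<lambda>n. cmod (\<gamma> (Suc n))) at_top sequentially"
proof (rule filterlim_at_top_mono)
  have "q ^ n * cmod (\<gamma> 1) \<le> cmod (\<gamma> (Suc n))" for n
  proof (induction n)
    case (Suc n)
    have "q ^ Suc n * cmod (\<gamma> 1) \<le> q * cmod (\<gamma> (Suc n))"
      using Suc q by simp
    then show ?case using growth[of "Suc n"] by simp
  qed simp
  then show "\<forall>\<^sub>F n in sequentially. cmod (\<gamma> 1) * q ^ n \<le> cmod (\<gamma> (Suc n))"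
    by (simp add: mult.commute)
  show "filterlim (\<lambda>n. cmod (\<gamma> 1) * q ^ n) at_top sequentially"
    using q nonzero[of 1]
    by (intro filterlim_tendsto_pos_mult_at_top[OF tendsto_const]
        filterlim_at_infinity_imp_filterlim_at_top[OF filterlim_realpow_sequentially_gt1]) auto
qed

lemma Omega_lower:
  assumes "m > 1" "z \<in> Omega \<gamma> m"
  shows "(cmod (\<gamma> (m - 1)) + cmod (\<gamma> m)) / 2 \<le> cmod z"
  using assms by (simp add: Omega_def)

lemma Omega_upper:
  assumes "m \<ge> 1" "z \<in> Omega \<gamma> m"
  shows "cmod z < (cmod (\<gamma> m) + cmod (\<gamma> (Suc m))) / 2"
  using assms by (cases "m = 1") (auto simp: Omega_def numeral_2_eq_2)

lemma Omega_inner: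
  assumes "1 \<le> l" "l < m" "z \<in> Omega \<gamma> m"
  shows "cmod (\<gamma> l) \<le> \<theta> * cmod z" "z \<noteq> 0"
proof -
  have "q * cmod (\<gamma> (m - 1)) \<le> cmod (\<gamma> m)"
    using growth[of "m - 1"] assms by simp
  then have "(1 + q) / 2 * cmod (\<gamma> (m - 1)) \<le> cmod z"
    using Omega_lower[of m z] assms by (simp add: algebra_simps)
  moreover have "(1 + q) / 2 * cmod (\<gamma> l) \<le> (1 + q) / 2 * cmod (\<gamma> (m - 1))"
    using q assms by (intro mult_left_mono cmod_mono) auto
  ultimately have z: "(1 + q) / 2 * cmod (\<gamma> l) \<le> cmod z" by linarith
  \<comment> \<open>The inner radius yields the ratio \<open>2 / (1 + q)\<close>. It is at most
    \<open>\<theta>\<close> because \<open>4 * q \<le> (1 + q)\<^sup>2\<close>, so one constant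
    serves both sides of the diagonal.\<close>
  have "0 \<le> (q - 1)\<^sup>2" by simp
  then have "1 \<le> \<theta> * ((1 + q) / 2)"
    using q by (simp add: \<theta>_def field_simps power2_eq_square)
  from mult_right_mono[OF this, of "cmod (\<gamma> l)"]
  have "cmod (\<gamma> l) \<le> \<theta> * ((1 + q) / 2) * cmod (\<gamma> l)" by simp
  also have "\<dots> \<le> \<theta> * cmod z"
    using mult_left_mono[OF z, of \<theta>] \<theta> by (simp add: mult.assoc)
  finally show bound: "cmod (\<gamma> l) \<le> \<theta> * cmod z" .
  show "z \<noteq> 0" using bound nonzero[of l] assms by auto
qed

lemma Omega_outer:
  assumes "1 \<le> m" "m < l" "z \<in> Omega \<gamma> m"
  shows "cmod z \<le> \<theta> * cmod (\<gamma> l)"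
proof -
  have "q * (2 * cmod z) \<le> q * (cmod (\<gamma> m) + cmod (\<gamma> (Suc m)))"
    using Omega_upper[of m z] assms q by (intro mult_left_mono) auto
  then have "cmod z \<le> \<theta> * cmod (\<gamma> (Suc m))"
    using growth[of m] assms q by (simp add: \<theta>_def field_simps)
  also have "\<dots> \<le> \<theta> * cmod (\<gamma> l)"
    using \<theta> assms by (intro mult_left_mono cmod_mono) auto
  finally show ?thesis .
qed

lemma Omega_disjoint: "disjoint_family_on (Omega \<gamma>) {1..}"
proof -
  have "Omega \<gamma> i \<inter> Omega \<gamma> j = {}" if "1 \<le> i" "i < j" for i j
  proof -
    have "cmod (\<gamma> i) + cmod (\<gamma> (Suc i)) \<le> cmod (\<gamma> (j - 1)) + cmod (\<gamma> j)"
      using that by (intro add_mono cmod_mono) auto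
    then show ?thesis using Omega_upper[of i] Omega_lower[of j] that by fastforce
  qed
  then show ?thesis
    unfolding disjoint_family_on_def by (metis Int_commute atLeast_iff linorder_neqE_nat)
qed

text \<open>The shell of \<open>z\<close> is the first one whose outer radius exceeds
  \<open>|z|\<close>. Minimality supplies the inner bound, and a least index 0 means the central
  disc.\<close>

lemma Omega_cover: "\<exists>m. z \<in> Omega \<gamma> (Suc m)"
proof -
  define P where "P m \<longleftrightarrow> cmod z < (cmod (\<gamma> (Suc m)) + cmod (\<gamma> (Suc (Suc m)))) / 2" for m
  have "\<forall>\<^sub>F m in sequentially. cmod z < cmod (\<gamma> (Suc m))"
    using cmod_at_top by (simp add: filterlim_at_top_dense)
  then obtain m where "cmod z < cmod (\<gamma> (Suc m))"
    by (auto simp: eventually_sequentially)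
  then have "P m" using cmod_mono[of "Suc m" "Suc (Suc m)"] by (simp add: P_def)
  then have least: "P (LEAST m. P m)" and "\<And>k. k < (LEAST m. P m) \<Longrightarrow> \<not> P k"
    by (auto intro: LeastI dest: not_less_Least)
  then have "z \<in> Omega \<gamma> (Suc (LEAST m. P m))"
    by (cases "LEAST m. P m") (auto simp: Omega_def P_def numeral_2_eq_2 not_less)
  then show ?thesis ..
qed

lemma Omega_borel [measurable]: "Omega \<gamma> n \<in> sets borel"
  by (cases "n = 1") (simp_all add: Omega_def)

end

section \<open>Convergence of the series and a pointwise bound on each shell\<close>

locale weighted_sparse_sequence = sparse_sequence +
  fixes v :: "nat \<Rightarrow> real" and \<mu> :: "complex measure"
  assumes vpos: "\<And>n. n \<ge> 1 \<Longrightarrow> v n > 0"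
    and admissible: "summable (\<lambda>n. v (Suc n) / (1 + (cmod (\<gamma> (Suc n)))\<^sup>2))"
    and sets_\<mu> [measurable_cong]: "sets \<mu> = sets borel"
begin

lemma Hop_measurable [measurable]: "Hop \<gamma> v a \<in> borel_measurable \<mu>"
  unfolding Hop_def by measurable

text \<open>Cauchy-Schwarz in the form \<open>x * y \<le> x\<^sup>2 + y\<^sup>2\<close>: each term
  is dominated by \<open>|a|\<^sup>2 v + v / |z - \<gamma>|\<^sup>2\<close>, and far out the second
  part is comparable to the admissibility weight. Only the tail is compared, so \<open>z\<close> may
  lie on the sequence itself.\<close>

lemma summable_Hop:
  assumes "lv2 v a"
  shows "summable (\<lambda>n. a (Suc n) * complex_of_real (v (Suc n)) / (z - \<gamma> (Suc n)))"
proof (rule summable_comparison_test_ev)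
  show "summable (\<lambda>n. (cmod (a (Suc n)))\<^sup>2 * v (Suc n)
      + 8 * (v (Suc n) / (1 + (cmod (\<gamma> (Suc n)))\<^sup>2)))"
    using assms admissible unfolding lv2_def by (intro summable_add summable_mult)
  \<comment> \<open>Beyond \<open>2 |z|\<close> the distance to \<open>z\<close> is at least half of
    \<open>|\<gamma>|\<close>, which costs a factor 4 after squaring; beyond 1 one has
    \<open>1 + r\<^sup>2 \<le> 2 * r\<^sup>2\<close>. Together these give the 8.\<close>
  have "\<forall>\<^sub>F n in sequentially. max 1 (2 * cmod z) \<le> cmod (\<gamma> (Suc n))"
    using cmod_at_top unfolding filterlim_at_top by blast
  then show "\<forall>\<^sub>F n in sequentially.
      cmod (a (Suc n) * complex_of_real (v (Suc n)) / (z - \<gamma> (Suc n)))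
      \<le> (cmod (a (Suc n)))\<^sup>2 * v (Suc n) + 8 * (v (Suc n) / (1 + (cmod (\<gamma> (Suc n)))\<^sup>2))"
  proof eventually_elim
    case (elim n)
    let ?d = "cmod (z - \<gamma> (Suc n))" and ?r = "cmod (\<gamma> (Suc n))"
      and ?x = "cmod (a (Suc n))" and ?w = "v (Suc n)"
    have w: "?w > 0" by (simp add: vpos)
    have r: "1 \<le> ?r" using elim by simp
    have d: "?r / 2 \<le> ?d"
      using norm_triangle_ineq3[of z "\<gamma> (Suc n)"] elim by linarith
    have "1 + ?r\<^sup>2 \<le> 2 * ?r\<^sup>2" using r by simp
    also have "\<dots> = 8 * (?r / 2)\<^sup>2" by (simp add: power_divide)
    also have "\<dots> \<le> 8 * ?d\<^sup>2" using d by (intro mult_left_mono power_mono) auto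
    finally have "8 / (8 * ?d\<^sup>2) \<le> 8 / (1 + ?r\<^sup>2)"
      by (intro frac_le) (auto intro: add_pos_nonneg)
    then have "1 / ?d\<^sup>2 \<le> 8 / (1 + ?r\<^sup>2)" by simp
    then have "?w * (1 / ?d\<^sup>2) \<le> ?w * (8 / (1 + ?r\<^sup>2))"
      using w by (intro mult_left_mono) auto
    moreover have "?x * (1 / ?d) \<le> ?x\<^sup>2 + (1 / ?d)\<^sup>2"
      using zero_le_power2[of "?x - 1 / ?d"] zero_le_power2[of "?x"] zero_le_power2[of "1 / ?d"]
      unfolding power2_diff by linarith
    then have "?w * (?x * (1 / ?d)) \<le> ?w * (?x\<^sup>2 + (1 / ?d)\<^sup>2)"
      using w by (intro mult_left_mono) auto
    ultimately show ?case
      using w by (simp add: norm_mult norm_divide algebra_simps power_divide)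
  qed
qed

text \<open>The sum is split at the diagonal index, and sparseness simplifies the kernel on either
  side. The last sum is written with \<open>|a| |\<gamma>|\<close> against
  \<open>v / |\<gamma>|\<^sup>2\<close> to fit the dual Hardy inequality: the square of the former
  times the latter is again \<open>|a|\<^sup>2 v\<close>.\<close>

lemma Hop_partial_sum_bound:
  assumes "m < N" "z \<in> Omega \<gamma> (Suc m)"
  shows "(cmod (\<Sum>l<N. a (Suc l) * complex_of_real (v (Suc l)) / (z - \<gamma> (Suc l))))\<^sup>2
    \<le> 3 * (1 / (1 - \<theta>) * (\<Sum>l<m. cmod (a (Suc l)) * v (Suc l)))\<^sup>2 * (1 / (cmod z)\<^sup>2)
     + 3 * ((cmod (a (Suc m)))\<^sup>2 * v (Suc m)) * (v (Suc m) / (cmod (z - \<gamma> (Suc m)))\<^sup>2)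
     + 3 * (1 / (1 - \<theta>) * (\<Sum>l=Suc m..<N.
          cmod (a (Suc l)) * cmod (\<gamma> (Suc l)) * (v (Suc l) / (cmod (\<gamma> (Suc l)))\<^sup>2)))\<^sup>2"
proof -
  define f where "f l = cmod (a (Suc l)) * v (Suc l) * (1 / cmod (z - \<gamma> (Suc l)))" for l
  define \<kappa> where "\<kappa> = 1 / (1 - \<theta>)"
  define S where "S = \<kappa> * (\<Sum>l<m. cmod (a (Suc l)) * v (Suc l)) / cmod z"
  define R where "R = \<kappa> * (\<Sum>l=Suc m..<N.
          cmod (a (Suc l)) * cmod (\<gamma> (Suc l)) * (v (Suc l) / (cmod (\<gamma> (Suc l)))\<^sup>2))"
  have f0: "f l \<ge> 0" for l using vpos[of "Suc l"] by (simp add: f_def)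
  have head: "(\<Sum>l<m. f l) \<le> S"
    unfolding S_def sum_distrib_left sum_divide_distrib
  proof (rule sum_mono)
    fix l assume "l \<in> {..<m}"
    then have "1 / cmod (z - \<gamma> (Suc l)) \<le> \<kappa> / cmod z"
      using cmod_inverse_diff_le[OF Omega_inner(1)[of "Suc l" "Suc m" z] \<theta>(2)]
        Omega_inner(2)[of "Suc l" "Suc m" z] assms by (simp add: \<kappa>_def)
    then have "f l \<le> cmod (a (Suc l)) * v (Suc l) * (\<kappa> / cmod z)"
      unfolding f_def using vpos[of "Suc l"] by (intro mult_left_mono) auto
    then show "f l \<le> \<kappa> * (cmod (a (Suc l)) * v (Suc l)) / cmod z" by (simp add: mult_ac)
  qed
  have tail: "(\<Sum>l=Suc m..<N. f l) \<le> R"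
    unfolding R_def sum_distrib_left
  proof (rule sum_mono)
    fix l assume "l \<in> {Suc m..<N}"
    then have "1 / cmod (z - \<gamma> (Suc l)) \<le> \<kappa> / cmod (\<gamma> (Suc l))"
      using cmod_inverse_diff_le[OF Omega_outer[of "Suc m" "Suc l" z] \<theta>(2)] nonzero[of "Suc l"]
        assms by (simp add: \<kappa>_def norm_minus_commute)
    then have "f l \<le> cmod (a (Suc l)) * v (Suc l) * (\<kappa> / cmod (\<gamma> (Suc l)))"
      unfolding f_def using vpos[of "Suc l"] by (intro mult_left_mono) auto
    then show "f l \<le> \<kappa> * (cmod (a (Suc l)) * cmod (\<gamma> (Suc l)) * (v (Suc l) / (cmod (\<gamma> (Suc l)))\<^sup>2))"
      using nonzero[of "Suc l"] by (simp add: field_simps power2_eq_square)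
  qed
  have "cmod (\<Sum>l<N. a (Suc l) * complex_of_real (v (Suc l)) / (z - \<gamma> (Suc l)))
      \<le> (\<Sum>l<N. f l)"
    using vpos by (intro sum_norm_le) (simp add: f_def norm_mult norm_divide abs_of_pos)
  also have "(\<Sum>l<N. f l) = (\<Sum>l<m. f l) + f m + (\<Sum>l=Suc m..<N. f l)"
    using assms(1) sum.atLeastLessThan_concat[of 0 m N f]
    by (simp add: atLeast0LessThan sum.atLeast_Suc_lessThan)
  also have "\<dots> \<le> S + f m + R" using head tail by simp
  finally have "(cmod (\<Sum>l<N. a (Suc l) * complex_of_real (v (Suc l)) / (z - \<gamma> (Suc l))))\<^sup>2
      \<le> (S + f m + R)\<^sup>2" by (intro power_mono) auto
  \<comment> \<open>The difference of the two sides is the sum of the squares of the pairwise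
    differences.\<close>
  also have "\<dots> \<le> 3 * S\<^sup>2 + 3 * (f m)\<^sup>2 + 3 * R\<^sup>2"
    using zero_le_power2[of "S - f m"] zero_le_power2[of "S - R"] zero_le_power2[of "f m - R"]
    by (simp add: power2_eq_square algebra_simps)
  finally show ?thesis
    by (simp add: S_def R_def f_def \<kappa>_def power_mult_distrib power_divide mult_ac power2_eq_square)
qed

end

subsection \<open>Sufficiency\<close>

context weighted_sparse_sequence
begin

text \<open>On each shell the diagonal part is controlled by \<open>K1\<close>, the inner and outer
  parts by \<open>K2\<close> through the two Hardy inequalities. Each of the latter contributes
  \<open>3 * 4 * K2\<close> times the squared kernel constant, hence the 24.\<close>

lemma Hop_L2_le:
  assumes K1: "\<And>n. n \<ge> 1 \<Longrightarrow>
      (\<integral>\<^sup>+ z\<in>Omega \<gamma> n. ennreal (v n / (cmod (z - \<gamma> n))\<^sup>2) \<partial>\<mu>) \<le> ennreal K1"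
    and K2: "\<And>n. n \<ge> 1 \<Longrightarrow>
      ennreal (\<Sum>l=1..n. v l) *
        (\<Sum>m. (\<integral>\<^sup>+ z\<in>Omega \<gamma> (m + n + 1). ennreal (1 / (cmod z)\<^sup>2) \<partial>\<mu>))
      + (\<Sum>m=1..n. emeasure \<mu> (Omega \<gamma> m)) *
        (\<Sum>l. ennreal (v (l + n + 1) / (cmod (\<gamma> (l + n + 1)))\<^sup>2)) \<le> ennreal K2"
    and nonneg: "K1 \<ge> 0" "K2 \<ge> 0"
    and a: "lv2 v a"
  shows "(\<integral>\<^sup>+ z. ennreal ((cmod (Hop \<gamma> v a z))\<^sup>2) \<partial>\<mu>)
    \<le> ennreal ((3 * K1 + 24 * (1 / (1 - \<theta>))\<^sup>2 * K2) * lv2_norm_sq v a)"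
proof -
  define \<kappa> where "\<kappa> = 1 / (1 - \<theta>)"
  define p where "p n = (\<integral>\<^sup>+ z\<in>Omega \<gamma> n. ennreal (1 / (cmod z)\<^sup>2) \<partial>\<mu>)" for n
  define P where "P m = enn2real (p (Suc m))" for m
  define Q where "Q m = enn2real (emeasure \<mu> (Omega \<gamma> (Suc m)))" for m
  define u where "u l = v (Suc l) / (cmod (\<gamma> (Suc l)))\<^sup>2" for l
  define x where "x l = cmod (a (Suc l))" for l
  define V where "V l = v (Suc l)" for l
  have V: "V l > 0" for l by (simp add: V_def vpos)
  have u: "u l > 0" for l using nonzero[of "Suc l"] by (simp add: u_def vpos)
  have P0: "P m \<ge> 0" and Q0: "Q m \<ge> 0" for m by (simp_all add: P_def Q_def)
  have sum_V_pos: "0 < (\<Sum>l<n. V l)" if "n \<ge> 1" for n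
    using that V by (intro sum_pos) (auto simp: lessThan_empty_iff)
  have K2a: "ennreal (\<Sum>l<n. V l) * (\<Sum>m. p (m + n + 1)) \<le> ennreal K2"
    and K2b: "(\<Sum>m<n. emeasure \<mu> (Omega \<gamma> (Suc m))) * (\<Sum>l. ennreal (u (l + n))) \<le> ennreal K2"
    if "n \<ge> 1" for n
  proof -
    have sum_le: "ennreal (\<Sum>l<n. V l) * (\<Sum>m. p (m + n + 1))
        + (\<Sum>m<n. emeasure \<mu> (Omega \<gamma> (Suc m))) * (\<Sum>l. ennreal (u (l + n))) \<le> ennreal K2"
      using K2[OF that, unfolded One_nat_def sum.atLeast1_atMost_eq]
      by (simp add: p_def u_def V_def)
    show "ennreal (\<Sum>l<n. V l) * (\<Sum>m. p (m + n + 1)) \<le> ennreal K2"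
      by (rule order.trans[OF _ sum_le]) simp
    show "(\<Sum>m<n. emeasure \<mu> (Omega \<gamma> (Suc m))) * (\<Sum>l. ennreal (u (l + n))) \<le> ennreal K2"
      by (rule order.trans[OF _ sum_le]) simp
  qed
  \<comment> \<open>The first shell is left out: it contains 0, where \<open>1 / |z|\<^sup>2\<close>
    need not be integrable. If its integral is infinite, \<open>P 0\<close> takes the default value
    0, which is harmless because it only meets the empty sum \<open>S 0 = 0\<close>.\<close>
  have p_finite: "p (Suc m) < \<infinity>" if "m \<ge> 1" for m
  proof -
    have "ennreal (\<Sum>l<m. V l) * p (Suc m) \<le> ennreal (\<Sum>l<m. V l) * (\<Sum>i. p (i + m + 1))"
      using sum_le_suminf[of "\<lambda>i. p (i + m + 1)" "{0}"] by (intro mult_left_mono) auto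
    also have "\<dots> \<le> ennreal K2" using K2a that .
    finally have "ennreal (\<Sum>l<m. V l) * p (Suc m) < \<infinity>"
      using ennreal_less_top le_less_trans by fastforce
    then show ?thesis
      using sum_V_pos[OF that] by (auto simp: ennreal_mult_less_top)
  qed
  \<comment> \<open>The condition is used at \<open>Suc m\<close>, where the shell occurs in the
    finite sum and the tail contains the positive term \<open>u (Suc m)\<close>.\<close>
  have \<mu>_finite: "emeasure \<mu> (Omega \<gamma> (Suc m)) < \<infinity>" for m
  proof -
    have "emeasure \<mu> (Omega \<gamma> (Suc m)) * ennreal (u (Suc m))
        \<le> (\<Sum>i<Suc m. emeasure \<mu> (Omega \<gamma> (Suc i))) * (\<Sum>l. ennreal (u (l + Suc m)))"
      using sum_le_suminf[of "\<lambda>l. ennreal (u (l + Suc m))" "{0}"]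
      by (intro mult_mono) (auto simp: add_increasing)
    also have "\<dots> \<le> ennreal K2" by (rule K2b) simp
    finally have "emeasure \<mu> (Omega \<gamma> (Suc m)) * ennreal (u (Suc m)) < \<infinity>"
      using ennreal_less_top le_less_trans by fastforce
    then show ?thesis
      using u[of "Suc m"] by (auto simp: ennreal_mult_less_top)
  qed
  have P_eq: "ennreal (P m) = p (Suc m)" if "m \<ge> 1" for m
    using p_finite[OF that] by (simp add: P_def)
  have Q_eq: "ennreal (Q m) = emeasure \<mu> (Omega \<gamma> (Suc m))" for m
    using \<mu>_finite[of m] by (simp add: Q_def)
  have KP: "(\<Sum>l<n. V l) * (\<Sum>m=n..<N. P m) \<le> K2" if "0 < n" "n \<le> N" for n N
  proof -
    have "ennreal (\<Sum>m=n..<N. P m) = (\<Sum>m=n..<N. p (Suc m))"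
      using that by (simp add: P_eq[symmetric] P0)
    also have "\<dots> = (\<Sum>i<N - n. p (i + n + 1))"
      by (rule sum.reindex_bij_witness[of _ "\<lambda>i. i + n" "\<lambda>i. i - n"]) auto
    also have "\<dots> \<le> (\<Sum>i. p (i + n + 1))" by (intro sum_le_suminf) auto
    finally have "ennreal (\<Sum>l<n. V l) * ennreal (\<Sum>m=n..<N. P m) \<le> ennreal K2"
      using that by (intro order.trans[OF mult_left_mono K2a]) auto
    moreover have "0 \<le> (\<Sum>m=n..<N. P m)" by (intro sum_nonneg P0)
    ultimately show ?thesis
      using nonneg sum_V_pos[of n] that by (simp add: ennreal_mult'[symmetric])
  qed
  have KQ: "(\<Sum>m<n. Q m) * (\<Sum>l=n..<N. u l) \<le> K2" if "n < N" for n N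
  proof (cases "n = 0")
    case False
    have "ennreal (\<Sum>l=n..<N. u l) = (\<Sum>l=n..<N. ennreal (u l))"
      by (rule sum_ennreal[symmetric]) (simp add: u less_imp_le)
    also have "\<dots> = (\<Sum>i<N - n. ennreal (u (i + n)))"
      by (rule sum.reindex_bij_witness[of _ "\<lambda>i. i + n" "\<lambda>i. i - n"]) auto
    also have "\<dots> \<le> (\<Sum>i. ennreal (u (i + n)))" by (intro sum_le_suminf) auto
    finally have "(\<Sum>m<n. emeasure \<mu> (Omega \<gamma> (Suc m))) * ennreal (\<Sum>l=n..<N. u l) \<le> ennreal K2"
      using False by (intro order.trans[OF mult_left_mono K2b]) auto
    also have "(\<Sum>m<n. emeasure \<mu> (Omega \<gamma> (Suc m))) = ennreal (\<Sum>m<n. Q m)"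
      by (simp add: Q_eq[symmetric] Q0)
    finally have "ennreal (\<Sum>m<n. Q m) * ennreal (\<Sum>l=n..<N. u l) \<le> ennreal K2" .
    moreover have "0 \<le> (\<Sum>l=n..<N. u l)" "0 \<le> (\<Sum>m<n. Q m)"
      by (intro sum_nonneg Q0 less_imp_le[OF u])+
    ultimately show ?thesis
      using nonneg by (simp add: ennreal_mult'[symmetric])
  qed (use nonneg in simp)

  define H where "H N z = (\<Sum>l<N. a (Suc l) * complex_of_real (v (Suc l)) / (z - \<gamma> (Suc l)))" for N z
  have [measurable]: "H N \<in> borel_measurable \<mu>" for N
    unfolding H_def by measurable
  define S where "S m = (\<Sum>l<m. x l * V l)" for m
  define R where "R N m = (\<Sum>l=Suc m..<N. x l * cmod (\<gamma> (Suc l)) * u l)" for N m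

  have shell: "(\<integral>\<^sup>+ z\<in>Omega \<gamma> (Suc m). ennreal ((cmod (H N z))\<^sup>2) \<partial>\<mu>)
      \<le> ennreal (3 * (\<kappa> * S m)\<^sup>2 * P m + 3 * ((x m)\<^sup>2 * V m) * K1 + 3 * (\<kappa> * R N m)\<^sup>2 * Q m)"
    if "m < N" for m N
  proof -
    let ?i = "\<lambda>z. indicator (Omega \<gamma> (Suc m)) z :: ennreal"
    have "(\<integral>\<^sup>+ z. ennreal ((cmod (H N z))\<^sup>2) * ?i z \<partial>\<mu>)
        \<le> (\<integral>\<^sup>+ z. ennreal (3 * (\<kappa> * S m)\<^sup>2) * (ennreal (1 / (cmod z)\<^sup>2) * ?i z)
          + ennreal (3 * ((x m)\<^sup>2 * V m)) * (ennreal (V m / (cmod (z - \<gamma> (Suc m)))\<^sup>2) * ?i z)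
          + ennreal (3 * (\<kappa> * R N m)\<^sup>2) * ?i z \<partial>\<mu>)"
    proof (rule nn_integral_mono)
      fix z
      show "ennreal ((cmod (H N z))\<^sup>2) * ?i z
        \<le> ennreal (3 * (\<kappa> * S m)\<^sup>2) * (ennreal (1 / (cmod z)\<^sup>2) * ?i z)
          + ennreal (3 * ((x m)\<^sup>2 * V m)) * (ennreal (V m / (cmod (z - \<gamma> (Suc m)))\<^sup>2) * ?i z)
          + ennreal (3 * (\<kappa> * R N m)\<^sup>2) * ?i z"
      proof (cases "z \<in> Omega \<gamma> (Suc m)")
        case True
        have "ennreal ((cmod (H N z))\<^sup>2) \<le> ennreal (3 * (\<kappa> * S m)\<^sup>2 * (1 / (cmod z)\<^sup>2)
            + 3 * ((x m)\<^sup>2 * V m) * (V m / (cmod (z - \<gamma> (Suc m)))\<^sup>2) + 3 * (\<kappa> * R N m)\<^sup>2)"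
          using Hop_partial_sum_bound[OF that True, of a]
          unfolding H_def \<kappa>_def S_def R_def x_def V_def u_def by (intro ennreal_leI)
        also have "\<dots> = ennreal (3 * (\<kappa> * S m)\<^sup>2) * ennreal (1 / (cmod z)\<^sup>2)
          + ennreal (3 * ((x m)\<^sup>2 * V m)) * ennreal (V m / (cmod (z - \<gamma> (Suc m)))\<^sup>2)
          + ennreal (3 * (\<kappa> * R N m)\<^sup>2)"
          using V[of m] by (simp add: ennreal_mult[symmetric] ennreal_plus[symmetric] del: ennreal_plus)
        finally show ?thesis using True by simp
      qed simp
    qed
    also have "\<dots> = ennreal (3 * (\<kappa> * S m)\<^sup>2) * p (Suc m)
        + ennreal (3 * ((x m)\<^sup>2 * V m)) * (\<integral>\<^sup>+ z. ennreal (V m / (cmod (z - \<gamma> (Suc m)))\<^sup>2) * ?i z \<partial>\<mu>)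
        + ennreal (3 * (\<kappa> * R N m)\<^sup>2) * emeasure \<mu> (Omega \<gamma> (Suc m))"
      by (simp add: nn_integral_add nn_integral_cmult p_def sets_\<mu>)
    also have "\<dots> \<le> ennreal (3 * (\<kappa> * S m)\<^sup>2 * P m) + ennreal (3 * ((x m)\<^sup>2 * V m) * K1)
        + ennreal (3 * (\<kappa> * R N m)\<^sup>2 * Q m)"
    proof (intro add_mono)
      show "ennreal (3 * (\<kappa> * S m)\<^sup>2) * p (Suc m) \<le> ennreal (3 * (\<kappa> * S m)\<^sup>2 * P m)"
        by (cases "m = 0") (simp_all add: S_def P_eq[symmetric] ennreal_mult P0)
      have "(\<integral>\<^sup>+ z. ennreal (V m / (cmod (z - \<gamma> (Suc m)))\<^sup>2) * ?i z \<partial>\<mu>) \<le> ennreal K1"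
        using K1[of "Suc m"] by (simp add: V_def)
      then show "ennreal (3 * ((x m)\<^sup>2 * V m))
          * (\<integral>\<^sup>+ z. ennreal (V m / (cmod (z - \<gamma> (Suc m)))\<^sup>2) * ?i z \<partial>\<mu>)
          \<le> ennreal (3 * ((x m)\<^sup>2 * V m) * K1)"
        using V[of m] nonneg by (simp add: ennreal_mult mult_left_mono)
    qed (simp add: ennreal_mult Q0 Q_eq)
    also have "\<dots> = ennreal (3 * (\<kappa> * S m)\<^sup>2 * P m + 3 * ((x m)\<^sup>2 * V m) * K1 + 3 * (\<kappa> * R N m)\<^sup>2 * Q m)"
      using V[of m] nonneg P0[of m] Q0[of m] by (simp add: ennreal_plus[symmetric] del: ennreal_plus)
    finally show ?thesis .
  qed

  have norm_le: "(\<Sum>l<N. (x l)\<^sup>2 * V l) \<le> lv2_norm_sq v a" for N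
    unfolding lv2_norm_sq_def x_def V_def
    using a vpos by (intro sum_le_suminf) (auto simp: lv2_def less_imp_le)
  have shell_sum: "(\<Sum>m<N. 3 * (\<kappa> * S m)\<^sup>2 * P m + 3 * ((x m)\<^sup>2 * V m) * K1 + 3 * (\<kappa> * R N m)\<^sup>2 * Q m)
      \<le> (3 * K1 + 24 * \<kappa>\<^sup>2 * K2) * lv2_norm_sq v a" for N
  proof -
    let ?n = "\<Sum>l<N. (x l)\<^sup>2 * V l"
    have 1: "(\<Sum>m<N. P m * (S m)\<^sup>2) \<le> 4 * K2 * ?n"
      unfolding S_def by (intro weighted_hardy V P0 KP) (simp add: x_def)
    have "(\<Sum>m<N. Q m * (R N m)\<^sup>2) \<le> 4 * K2 * (\<Sum>l<N. (x l * cmod (\<gamma> (Suc l)))\<^sup>2 * u l)"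
      unfolding R_def by (intro weighted_hardy_dual u Q0 KQ) (simp add: x_def)
    also have "(\<Sum>l<N. (x l * cmod (\<gamma> (Suc l)))\<^sup>2 * u l) = ?n"
      using nonzero by (intro sum.cong) (auto simp: u_def V_def power_mult_distrib)
    finally have 2: "(\<Sum>m<N. Q m * (R N m)\<^sup>2) \<le> 4 * K2 * ?n" .
    have "(\<Sum>m<N. 3 * (\<kappa> * S m)\<^sup>2 * P m + 3 * ((x m)\<^sup>2 * V m) * K1 + 3 * (\<kappa> * R N m)\<^sup>2 * Q m)
        = 3 * \<kappa>\<^sup>2 * (\<Sum>m<N. P m * (S m)\<^sup>2) + 3 * K1 * ?n + 3 * \<kappa>\<^sup>2 * (\<Sum>m<N. Q m * (R N m)\<^sup>2)"
      by (simp add: sum.distrib sum_distrib_left power_mult_distrib mult_ac)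
    also have "\<dots> \<le> 3 * \<kappa>\<^sup>2 * (4 * K2 * ?n) + 3 * K1 * ?n + 3 * \<kappa>\<^sup>2 * (4 * K2 * ?n)"
      using 1 2 by (intro add_mono mult_left_mono order.refl) auto
    also have "\<dots> = (3 * K1 + 24 * \<kappa>\<^sup>2 * K2) * ?n" by (simp add: algebra_simps)
    also have "\<dots> \<le> (3 * K1 + 24 * \<kappa>\<^sup>2 * K2) * lv2_norm_sq v a"
      using nonneg norm_le by (intro mult_left_mono) auto
    finally show ?thesis .
  qed

  \<comment> \<open>The shell estimates cover only \<open>m < N\<close>, so Fatou's lemma is applied
    to the partial sums restricted to the first \<open>N\<close> shells. A fixed \<open>z\<close>
    lies in some shell and is counted for all large \<open>N\<close>.\<close>
  let ?f = "\<lambda>N z. \<Sum>m<N. ennreal ((cmod (H N z))\<^sup>2) * indicator (Omega \<gamma> (Suc m)) z"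
  have "(\<integral>\<^sup>+ z. ennreal ((cmod (Hop \<gamma> v a z))\<^sup>2) \<partial>\<mu>) \<le> (\<integral>\<^sup>+ z. liminf (\<lambda>N. ?f N z) \<partial>\<mu>)"
  proof (rule nn_integral_mono)
    fix z
    have "(\<lambda>N. H N z) \<longlonglongrightarrow> Hop \<gamma> v a z"
      unfolding H_def Hop_def by (rule summable_LIMSEQ[OF summable_Hop[OF a]])
    then have "(\<lambda>N. ennreal ((cmod (H N z))\<^sup>2)) \<longlonglongrightarrow> ennreal ((cmod (Hop \<gamma> v a z))\<^sup>2)"
      by (intro tendsto_intros)
    then have "ennreal ((cmod (Hop \<gamma> v a z))\<^sup>2) = liminf (\<lambda>N. ennreal ((cmod (H N z))\<^sup>2))"
      by (rule lim_imp_Liminf[OF sequentially_bot, symmetric])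
    also have "\<dots> \<le> liminf (\<lambda>N. ?f N z)"
    proof (rule Liminf_mono)
      obtain m where m: "z \<in> Omega \<gamma> (Suc m)" using Omega_cover by blast
      have "ennreal ((cmod (H N z))\<^sup>2) \<le> ?f N z" if "m < N" for N
        using member_le_sum[of m "{..<N}" "\<lambda>m. ennreal ((cmod (H N z))\<^sup>2) * indicator (Omega \<gamma> (Suc m)) z"]
          that m by simp
      then show "\<forall>\<^sub>F N in sequentially. ennreal ((cmod (H N z))\<^sup>2) \<le> ?f N z"
        using eventually_gt_at_top[of m] by (rule eventually_mono[rotated])
    qed
    finally show "ennreal ((cmod (Hop \<gamma> v a z))\<^sup>2) \<le> liminf (\<lambda>N. ?f N z)" .
  qed
  also have "\<dots> \<le> liminf (\<lambda>N. \<integral>\<^sup>+ z. ?f N z \<partial>\<mu>)"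
    by (rule nn_integral_liminf) simp
  also have "\<dots> \<le> liminf (\<lambda>N::nat. ennreal ((3 * K1 + 24 * \<kappa>\<^sup>2 * K2) * lv2_norm_sq v a))"
  proof (intro Liminf_mono always_eventually allI)
    fix N
    have "(\<integral>\<^sup>+ z. ?f N z \<partial>\<mu>)
        = (\<Sum>m<N. \<integral>\<^sup>+ z\<in>Omega \<gamma> (Suc m). ennreal ((cmod (H N z))\<^sup>2) \<partial>\<mu>)"
      by (rule nn_integral_sum) simp
    also have "\<dots> \<le> (\<Sum>m<N. ennreal (3 * (\<kappa> * S m)\<^sup>2 * P m + 3 * ((x m)\<^sup>2 * V m) * K1 + 3 * (\<kappa> * R N m)\<^sup>2 * Q m))"
      by (intro sum_mono shell) simp
    also have "\<dots> = ennreal (\<Sum>m<N. 3 * (\<kappa> * S m)\<^sup>2 * P m + 3 * ((x m)\<^sup>2 * V m) * K1 + 3 * (\<kappa> * R N m)\<^sup>2 * Q m)"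
      using V P0 Q0 nonneg by (intro sum_ennreal) (simp add: less_imp_le)
    also have "\<dots> \<le> ennreal ((3 * K1 + 24 * \<kappa>\<^sup>2 * K2) * lv2_norm_sq v a)"
      by (intro ennreal_leI shell_sum)
    finally show "(\<integral>\<^sup>+ z. ?f N z \<partial>\<mu>) \<le> ennreal ((3 * K1 + 24 * \<kappa>\<^sup>2 * K2) * lv2_norm_sq v a)" .
  qed
  finally show ?thesis by (simp add: Liminf_const \<kappa>_def)
qed

end

subsection \<open>Necessity\<close>

locale bounded_Hop = weighted_sparse_sequence +
  fixes C :: real
  assumes C: "C \<ge> 0"
    and bounded: "\<And>a. lv2 v a \<Longrightarrow>
      (\<integral>\<^sup>+ z. ennreal ((cmod (Hop \<gamma> v a z))\<^sup>2) \<partial>\<mu>) \<le> ennreal (C * lv2_norm_sq v a)"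
begin

text \<open>Common scheme for all test sequences: if \<open>f\<close> is at most \<open>c\<close>
  times \<open>|Hop a|\<^sup>2\<close> divided by the squared norm of \<open>a\<close> on
  \<open>E\<close>, boundedness integrates this to \<open>c * C\<close>.\<close>

lemma test_function_bound:
  assumes F: "finite F" "F \<subseteq> {1..}" and a: "\<And>n. n \<notin> F \<Longrightarrow> a n = 0"
    and pos: "0 < (\<Sum>l\<in>F. (cmod (a l))\<^sup>2 * v l)" and c: "c \<ge> 0"
    and le: "\<And>z. z \<in> E \<Longrightarrow> (\<Sum>l\<in>F. (cmod (a l))\<^sup>2 * v l) * f z
        \<le> c * (cmod (\<Sum>l\<in>F. a l * complex_of_real (v l) / (z - \<gamma> l)))\<^sup>2"
  shows "(\<integral>\<^sup>+ z\<in>E. ennreal (f z) \<partial>\<mu>) \<le> ennreal (c * C)"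
proof -
  define W where "W = (\<Sum>l\<in>F. (cmod (a l))\<^sup>2 * v l)"
  have F0: "0 \<notin> F" using F by auto
  have "(\<lambda>n. (cmod (a (Suc n)))\<^sup>2 * v (Suc n)) sums W"
    unfolding W_def using F F0 a by (intro sums_Suc_finite) auto
  then have lv2: "lv2 v a" and norm: "lv2_norm_sq v a = W"
    by (auto simp: lv2_def lv2_norm_sq_def sums_iff)
  have "(\<lambda>n. a (Suc n) * complex_of_real (v (Suc n)) / (z - \<gamma> (Suc n))) sums
      (\<Sum>l\<in>F. a l * complex_of_real (v l) / (z - \<gamma> l))" for z
    using F F0 a by (intro sums_Suc_finite) auto
  then have Hop: "Hop \<gamma> v a z = (\<Sum>l\<in>F. a l * complex_of_real (v l) / (z - \<gamma> l))" for z
    by (simp add: Hop_def sums_iff)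
  have W: "W > 0" using pos by (simp add: W_def)
  have "(\<integral>\<^sup>+ z\<in>E. ennreal (f z) \<partial>\<mu>)
      \<le> (\<integral>\<^sup>+ z. ennreal (c / W) * ennreal ((cmod (Hop \<gamma> v a z))\<^sup>2) \<partial>\<mu>)"
  proof (rule nn_integral_mono)
    fix z
    show "ennreal (f z) * indicator E z \<le> ennreal (c / W) * ennreal ((cmod (Hop \<gamma> v a z))\<^sup>2)"
      using le[of z, folded W_def Hop] W c
      by (auto simp: ennreal_mult[symmetric] field_simps
          split: split_indicator intro!: ennreal_leI)
  qed
  also have "\<dots> = ennreal (c / W) * (\<integral>\<^sup>+ z. ennreal ((cmod (Hop \<gamma> v a z))\<^sup>2) \<partial>\<mu>)"
    by (rule nn_integral_cmult) measurable
  also have "\<dots> \<le> ennreal (c / W) * ennreal (C * W)"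
    using bounded[OF lv2] by (intro mult_left_mono) (simp_all add: norm)
  also have "\<dots> = ennreal (c * C)"
    using W c C by (simp add: ennreal_mult[symmetric])
  finally show ?thesis .
qed

text \<open>For the unit vector at \<open>n\<close> the squared norm is \<open>v n\<close> and the
  transform is the single term \<open>v n / (z - \<gamma> n)\<close>, so the test quotient is
  exactly the integrand.\<close>

lemma diagonal_bound:
  assumes "n \<ge> 1"
  shows "(\<integral>\<^sup>+ z\<in>Omega \<gamma> n. ennreal (v n / (cmod (z - \<gamma> n))\<^sup>2) \<partial>\<mu>) \<le> ennreal C"
  using test_function_bound[of "{n}" "\<lambda>l. if l = n then 1 else 0"
      1 "Omega \<gamma> n" "\<lambda>z. v n / (cmod (z - \<gamma> n))\<^sup>2"] assms vpos[OF assms]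
  by (auto simp: norm_divide power_divide power2_eq_square)

text \<open>Test on the indicator of \<open>{1..n}\<close>, of squared norm \<open>W\<close>. On
  later shells multiplication by \<open>z\<close> gives every term a real part of at least half its
  weight, so \<open>|z| |Hop a| \<ge> W / 2\<close>; squaring produces the 4.\<close>

lemma sum_below_bound:
  assumes "n \<ge> 1"
  shows "ennreal (\<Sum>l=1..n. v l) *
      (\<Sum>m. (\<integral>\<^sup>+ z\<in>Omega \<gamma> (m + n + 1). ennreal (1 / (cmod z)\<^sup>2) \<partial>\<mu>)) \<le> ennreal (4 * C)"
proof -
  define W where "W = (\<Sum>l=1..n. v l)"
  define E where "E = (\<Union>m. Omega \<gamma> (m + n + 1))"
  have W: "W > 0" unfolding W_def using assms vpos by (intro sum_pos) auto
  have disj: "disjoint_family (\<lambda>m. Omega \<gamma> (m + n + 1))"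
    using Omega_disjoint by (auto simp: disjoint_family_on_def)
  have E: "E \<in> sets borel" unfolding E_def by measurable
  have "(\<integral>\<^sup>+ z\<in>E. ennreal (W * (1 / (cmod z)\<^sup>2)) \<partial>\<mu>) \<le> ennreal (4 * C)"
  proof (rule test_function_bound[where a = "\<lambda>l. if l \<in> {1..n} then 1 else 0"])
    fix z assume "z \<in> E"
    then obtain m where z: "z \<in> Omega \<gamma> (m + n + 1)" by (auto simp: E_def)
    let ?H = "\<Sum>l=1..n. complex_of_real (v l) / (z - \<gamma> l)"
    have z0: "z \<noteq> 0" using Omega_inner(2)[of 1, OF _ _ z] assms by simp
    have "W / 2 = (\<Sum>l=1..n. v l * (1 / 2))" by (simp add: W_def sum_divide_distrib)
    also have "\<dots> \<le> (\<Sum>l=1..n. v l * Re (z / (z - \<gamma> l)))"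
    proof (intro sum_mono mult_left_mono Re_divide_diff_ge_half)
      fix l assume l: "l \<in> {1..n}"
      have "cmod (\<gamma> l) \<le> \<theta> * cmod z" using Omega_inner(1)[OF _ _ z, of l] l by simp
      also have "\<dots> < cmod z" using \<theta> z0 by simp
      finally show "cmod (\<gamma> l) < cmod z" .
      show "0 \<le> v l" using vpos[of l] l by simp
    qed
    also have "\<dots> = Re (\<Sum>l=1..n. complex_of_real (v l) * (z / (z - \<gamma> l)))"
      by (simp only: Re_sum scaleR_conv_of_real[symmetric] scaleR_complex.sel)
    also have "(\<Sum>l=1..n. complex_of_real (v l) * (z / (z - \<gamma> l))) = z * ?H"
      by (simp add: sum_distrib_left mult.commute)
    also have "Re (z * ?H) \<le> cmod z * cmod ?H"
      using complex_Re_le_cmod[of "z * ?H"] by (simp add: norm_mult)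
    finally have "(W / 2)\<^sup>2 \<le> (cmod z * cmod ?H)\<^sup>2" using W by (intro power_mono) auto
    then have "W * W / (cmod z)\<^sup>2 \<le> 4 * (cmod ?H)\<^sup>2"
      using z0 by (simp add: field_simps power2_eq_square)
    then show "(\<Sum>l\<in>{1..n}. (cmod (if l \<in> {1..n} then 1 else 0))\<^sup>2 * v l) * (W * (1 / (cmod z)\<^sup>2))
        \<le> 4 * (cmod (\<Sum>l\<in>{1..n}. (if l \<in> {1..n} then 1 else 0) * complex_of_real (v l) / (z - \<gamma> l)))\<^sup>2"
      by (simp add: W_def)
  qed (use W in \<open>auto simp: W_def\<close>)
  also have "(\<integral>\<^sup>+ z\<in>E. ennreal (W * (1 / (cmod z)\<^sup>2)) \<partial>\<mu>)
      = (\<integral>\<^sup>+ z. ennreal W * (ennreal (1 / (cmod z)\<^sup>2) * indicator E z) \<partial>\<mu>)"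
    using W by (intro nn_integral_cong) (simp add: ennreal_mult mult.assoc del: times_divide_eq_right)
  also have "\<dots> = ennreal W * (\<integral>\<^sup>+ z\<in>E. ennreal (1 / (cmod z)\<^sup>2) \<partial>\<mu>)"
    using E by (intro nn_integral_cmult) (simp add: sets_\<mu>)
  also have "(\<integral>\<^sup>+ z\<in>E. ennreal (1 / (cmod z)\<^sup>2) \<partial>\<mu>)
      = (\<Sum>m. (\<integral>\<^sup>+ z\<in>Omega \<gamma> (m + n + 1). ennreal (1 / (cmod z)\<^sup>2) \<partial>\<mu>))"
    unfolding E_def by (intro nn_integral_disjoint_family disj) (simp_all add: sets_\<mu>)
  finally show ?thesis by (simp add: W_def)
qed

text \<open>For \<open>a l = 1 / cnj (\<gamma> l)\<close> on a block after \<open>n\<close>, each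
  term of the transform is \<open>- u l * (\<gamma> l / (\<gamma> l - z))\<close>. Hence
  \<open>|Hop a| \<ge> U / 2\<close> on the first \<open>n\<close> shells, while the squared norm is
  \<open>U\<close>. The bound is uniform in the block length \<open>k\<close> and so passes to the
  series.\<close>

lemma sum_above_bound:
  assumes "n \<ge> 1"
  shows "(\<Sum>m=1..n. emeasure \<mu> (Omega \<gamma> m)) *
      (\<Sum>l. ennreal (v (l + n + 1) / (cmod (\<gamma> (l + n + 1)))\<^sup>2)) \<le> ennreal (4 * C)"
proof -
  define u where "u l = v l / (cmod (\<gamma> l))\<^sup>2" for l
  have u: "u l > 0" if "l \<ge> 1" for l using nonzero[OF that] vpos[OF that] by (simp add: u_def)
  define E where "E = (\<Union>m\<in>{1..n}. Omega \<gamma> m)"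
  have E: "E \<in> sets borel" unfolding E_def by measurable
  have "(\<Sum>m=1..n. emeasure \<mu> (Omega \<gamma> m)) = emeasure \<mu> E"
    unfolding E_def using Omega_disjoint
    by (intro sum_emeasure) (auto simp: disjoint_family_on_def sets_\<mu>)
  moreover have "emeasure \<mu> E * (\<Sum>l<k. ennreal (u (l + n + 1))) \<le> ennreal (4 * C)" for k
  proof -
    define F where "F = {n + 1..<n + 1 + k}"
    define U where "U = (\<Sum>l\<in>F. u l)"
    define a where "a l = (if l \<in> F then 1 / cnj (\<gamma> l) else 0)" for l
    have U0: "U \<ge> 0" unfolding U_def F_def by (intro sum_nonneg less_imp_le[OF u]) auto
    have U: "(\<Sum>l\<in>F. (cmod (a l))\<^sup>2 * v l) = U"
      by (simp add: U_def a_def u_def norm_divide power_divide)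
    have "(\<integral>\<^sup>+ z\<in>E. ennreal U \<partial>\<mu>) \<le> ennreal (4 * C)" if "U \<noteq> 0"
    proof (rule test_function_bound)
      fix z assume "z \<in> E"
      then obtain m where m: "m \<in> {1..n}" and z: "z \<in> Omega \<gamma> m" by (auto simp: E_def)
      let ?H = "\<Sum>l\<in>F. a l * complex_of_real (v l) / (z - \<gamma> l)"
      have "U / 2 = (\<Sum>l\<in>F. u l * (1 / 2))" by (simp add: U_def sum_divide_distrib)
      also have "\<dots> \<le> (\<Sum>l\<in>F. u l * Re (\<gamma> l / (\<gamma> l - z)))"
      proof (intro sum_mono mult_left_mono Re_divide_diff_ge_half)
        fix l assume l: "l \<in> F"
        have "cmod z \<le> \<theta> * cmod (\<gamma> l)" using Omega_outer[OF _ _ z, of l] l m by (simp add: F_def)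
        also have "\<dots> < cmod (\<gamma> l)" using \<theta> nonzero[of l] l by (simp add: F_def)
        finally show "cmod z < cmod (\<gamma> l)" .
        show "0 \<le> u l" using u[of l] l by (simp add: F_def)
      qed
      also have "\<dots> = Re (\<Sum>l\<in>F. complex_of_real (u l) * (\<gamma> l / (\<gamma> l - z)))"
        by (simp only: Re_sum scaleR_conv_of_real[symmetric] scaleR_complex.sel)
      also have "(\<Sum>l\<in>F. complex_of_real (u l) * (\<gamma> l / (\<gamma> l - z))) = - ?H"
        unfolding sum_negf[symmetric]
      proof (rule sum.cong)
        fix l assume l: "l \<in> F"
        have "complex_of_real (u l) * \<gamma> l = a l * complex_of_real (v l)"
          using nonzero[of l] l
          by (simp add: F_def u_def a_def complex_norm_square del: of_real_power)
        then show "complex_of_real (u l) * (\<gamma> l / (\<gamma> l - z))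
            = - (a l * complex_of_real (v l) / (z - \<gamma> l))"
          by (metis minus_diff_eq minus_divide_right times_divide_eq_right)
      qed simp
      also have "Re (- ?H) \<le> cmod ?H"
        using complex_Re_le_cmod[of "- ?H"] by (simp only: norm_minus_cancel)
      finally have "(U / 2)\<^sup>2 \<le> (cmod ?H)\<^sup>2" using U0 by (intro power_mono) auto
      then show "(\<Sum>l\<in>F. (cmod (a l))\<^sup>2 * v l) * U \<le> 4 * (cmod ?H)\<^sup>2"
        unfolding U by (simp add: power2_eq_square)
    qed (use U U0 that in \<open>auto simp: F_def a_def\<close>)
    \<comment> \<open>\<open>U = 0\<close> occurs only for the empty block \<open>k = 0\<close>, and
      then the left-hand side vanishes.\<close>
    then have "emeasure \<mu> E * ennreal U \<le> ennreal (4 * C)"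
      using E by (cases "U = 0") (auto simp: nn_integral_cmult sets_\<mu> mult.commute)
    moreover have "(\<Sum>l<k. ennreal (u (l + n + 1))) = (\<Sum>l\<in>F. ennreal (u l))"
      unfolding F_def
      by (rule sum.reindex_bij_witness[of _ "\<lambda>i. i - (n + 1)" "\<lambda>i. i + n + 1"]) auto
    moreover have "\<dots> = ennreal U"
      unfolding U_def by (intro sum_ennreal less_imp_le[OF u]) (auto simp: F_def)
    ultimately show ?thesis by simp
  qed
  then have "(\<Sum>l. emeasure \<mu> E * ennreal (u (l + n + 1))) \<le> ennreal (4 * C)"
    by (intro suminf_le_const summableI) (simp only: sum_distrib_left)
  ultimately show ?thesis by (simp add: u_def)
qed

end

section \<open>Equivalence of boundedness with the two suprema being finite\<close>

theorem theorem1: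
  fixes \<gamma> :: "nat \<Rightarrow> complex" and v :: "nat \<Rightarrow> real" and \<mu> :: "complex measure"
  assumes distinct: "inj_on \<gamma> {1..}"
    and sparse: "(INF n\<in>{1..}. cmod (\<gamma> (Suc n)) / cmod (\<gamma> n)) > 1"
    and vpos: "\<And>n. n \<ge> 1 \<Longrightarrow> v n > 0"
    and admissible: "summable (\<lambda>n. v (Suc n) / (1 + (cmod (\<gamma> (Suc n)))\<^sup>2))"
    and borel: "sets \<mu> = sets borel"
    and null: "emeasure \<mu> (\<gamma> ` {1..}) = 0"
  shows "(\<exists>C::real. \<forall>a. lv2 v a \<longrightarrow>
            Hop \<gamma> v a \<in> borel_measurable \<mu> \<and>
            (\<integral>\<^sup>+ z. ennreal ((cmod (Hop \<gamma> v a z))\<^sup>2) \<partial>\<mu>) \<le> ennreal (C * lv2_norm_sq v a))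
       \<longleftrightarrow>
         ((SUP n\<in>{1..}. (\<integral>\<^sup>+ z\<in>Omega \<gamma> n. ennreal (v n / (cmod (z - \<gamma> n))\<^sup>2) \<partial>\<mu>)) < \<infinity> \<and>
          (SUP n\<in>{1..}.
             ennreal (\<Sum>l=1..n. v l) *
               (\<Sum>m. (\<integral>\<^sup>+ z\<in>Omega \<gamma> (m + n + 1). ennreal (1 / (cmod z)\<^sup>2) \<partial>\<mu>))
           + (\<Sum>m=1..n. emeasure \<mu> (Omega \<gamma> m)) *
               (\<Sum>l. ennreal (v (l + n + 1) / (cmod (\<gamma> (l + n + 1)))\<^sup>2))) < \<infinity>)"
    (is "?bounded \<longleftrightarrow> (SUP n\<in>{1..}. ?A n) < \<infinity> \<and> (SUP n\<in>{1..}. ?B n) < \<infinity>")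
proof -
  define q where "q = (INF n\<in>{1..}. cmod (\<gamma> (Suc n)) / cmod (\<gamma> n))"
  have "bdd_below ((\<lambda>n. cmod (\<gamma> (Suc n)) / cmod (\<gamma> n)) ` {1..})"
    by (intro bdd_belowI2[of _ 0]) simp
  then have ratio: "q \<le> cmod (\<gamma> (Suc n)) / cmod (\<gamma> n)" if "n \<ge> 1" for n
    unfolding q_def using that by (intro cINF_lower) auto
  have q: "q > 1" using sparse by (simp add: q_def)
  \<comment> \<open>If \<open>\<gamma> n\<close> were 0, division by zero would make the ratio 0,
    against \<open>1 < q\<close>.\<close>
  have nonzero: "\<gamma> n \<noteq> 0" if "n \<ge> 1" for n
    using ratio[OF that] q by auto
  have growth: "q * cmod (\<gamma> n) \<le> cmod (\<gamma> (Suc n))" if "n \<ge> 1" for n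
    using ratio[OF that] nonzero[OF that] by (simp add: field_simps)
  interpret weighted_sparse_sequence \<gamma> q v \<mu>
    by unfold_locales (use q nonzero growth vpos admissible borel in auto)
  show ?thesis
  proof
    assume ?bounded
    then obtain C where C: "\<And>a. lv2 v a \<Longrightarrow>
        (\<integral>\<^sup>+ z. ennreal ((cmod (Hop \<gamma> v a z))\<^sup>2) \<partial>\<mu>) \<le> ennreal (C * lv2_norm_sq v a)"
      by blast
    \<comment> \<open>The given constant may be negative, in which case \<open>ennreal\<close>
      truncates the bound to 0; \<open>max C 0\<close> is still a valid bound.\<close>
    interpret bounded_Hop \<gamma> q v \<mu> "max C 0"
    proof
      fix a assume a: "lv2 v a"
      have "0 \<le> lv2_norm_sq v a"
        unfolding lv2_norm_sq_def
        using a vpos by (intro suminf_nonneg) (auto simp: lv2_def less_imp_le)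
      then have "ennreal (C * lv2_norm_sq v a) \<le> ennreal (max C 0 * lv2_norm_sq v a)"
        by (intro ennreal_leI mult_right_mono) auto
      with C[OF a] show "(\<integral>\<^sup>+ z. ennreal ((cmod (Hop \<gamma> v a z))\<^sup>2) \<partial>\<mu>)
          \<le> ennreal (max C 0 * lv2_norm_sq v a)" by (rule order.trans)
    qed simp
    have "(SUP n\<in>{1..}. ?A n) \<le> ennreal (max C 0)"
      by (intro SUP_least diagonal_bound) simp
    moreover have "(SUP n\<in>{1..}. ?B n) \<le> ennreal (4 * max C 0) + ennreal (4 * max C 0)"
      by (intro SUP_least add_mono sum_below_bound sum_above_bound) simp_all
    ultimately show "(SUP n\<in>{1..}. ?A n) < \<infinity> \<and> (SUP n\<in>{1..}. ?B n) < \<infinity>"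
      by (auto intro: le_less_trans)
  next
    assume fin: "(SUP n\<in>{1..}. ?A n) < \<infinity> \<and> (SUP n\<in>{1..}. ?B n) < \<infinity>"
    define K1 where "K1 = enn2real (SUP n\<in>{1..}. ?A n)"
    define K2 where "K2 = enn2real (SUP n\<in>{1..}. ?B n)"
    have K1: "?A n \<le> ennreal K1" if "n \<ge> 1" for n
      using fin that unfolding K1_def by (subst ennreal_enn2real) (auto intro: SUP_upper)
    have K2: "?B n \<le> ennreal K2" if "n \<ge> 1" for n
    proof -
      have "?B n \<le> (SUP n\<in>{1..}. ?B n)" using that by (intro SUP_upper) simp
      also have "\<dots> = ennreal K2" unfolding K2_def using fin by simp
      finally show ?thesis .
    qed
    have "0 \<le> K1" "0 \<le> K2" by (simp_all add: K1_def K2_def)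
    then show ?bounded using Hop_L2_le[OF K1 K2] Hop_measurable by blast
  qed
qed

end
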